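(* Let $n\in\{1,\dots,N\}$, fix $E_u>0$ and $\kappa\in[0,1]$, and set $p_u=E_u/M$, $M_0=\kappa M$, $M_1=(1-\kappa)M$, with all other parameters ($N$, $\rho$, $\alpha$, $\beta_i$, $K_i$, $\theta_i$, $k$, $d$) fixed. Then the closed-form approximate uplink achievable rate $R_{\mathrm{P},n}$ of user $n$ (MRC receiver, perfect CSI) given in the context satisfies $$R_{\mathrm{P},n}\to\log_2\left(1+E_u\beta_n(\rho\kappa+\alpha)\right)\qquad\text{as } M\to\infty.$$ In particular the limit does not depend on the Rician factors $K_1,\dots,K_N$. Moreover, since $\rho\kappa+\alpha=(1-\kappa)\alpha+\kappa$ with $\rho=1-\alpha$, the limit is a monotonically increasing (non-decreasing) function of $\kappa$ and of $\alpha$.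
   Context: Parameters of a mixed-ADC massive MIMO uplink: $N\ge 1$ users; $M=M_0+M_1$ base-station antennas, $M_0$ with high-resolution ADCs and $M_1$ with low-resolution ADCs, $\kappa=M_0/M$ (in the formulas below $M_0,M_1$ may be treated as nonnegative real numbers); distortion factor $\rho\in[0,1)$ of the low-resolution ADCs and $\alpha=1-\rho$; transmit power $p_u>0$; large-scale fading coefficients $\beta_i>0$; Rician factors $K_i\ge 0$; arrival angles $\theta_i\in\mathbb{R}$; real constants $k,d>0$ (only the product $kd$ matters). For $i\neq n$ and $j=0,1$ put $$\phi_{ni,j}=\frac{\sin\left(M_j kd(\sin\theta_n-\sin\theta_i)/2\right)}{\sin\left(kd(\sin\theta_n-\sin\theta_i)/2\right)},$$ where it is assumed that $\sin\left(kd(\sin\theta_n-\sin\theta_i)/2\right)\ne 0$ for all $i\ne n$, so that these are defined. Further put, for $i\ne n$ and $j=0,1$, $$\Delta_j=\Delta_j^{(i)}=\frac{K_nK_i\phi_{ni,j}^2+M_j(K_n+K_i+1)}{K_i+1},\qquad \Delta_2=M_1\left[\beta_n(K_n^2+4K_n+2)+(K_n+1)^2\sum_{i\neq n}\beta_i\right].$$ The closed-form approximate rate is $$R_{\mathrm{P},n}=\log_2\left(1+\frac{p_u\beta_n\left[(2K_n+1)(M_0+\alpha^2M_1)+(K_n+1)^2(M_0+\alpha M_1)^2\right]}{p_u(K_n+1)\sum_{i\ne n}\beta_i\left(\Delta_0^{(i)}+\alpha^2\Delta_1^{(i)}\right)+(K_n+1)^2(M_0+\alpha M_1)+\alpha\rho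 p_u\Delta_2}\right).$$ *)

theory Defs
  imports Complex_Main
begin

text \<open>
  Users are indexed by \<open>{1..N}\<close>; \<open>\<beta>\<close>, \<open>K\<close>, \<open>\<theta>\<close> give the large-scale fading coefficient, the
  Rician factor and the arrival angle of each user. The antenna numbers \<open>M\<^sub>0\<close> (high resolution)
  and \<open>M\<^sub>1\<close> (low resolution) are real, since \<open>\<kappa> M\<close> need not be an integer.
\<close>

definition phi :: "real \<Rightarrow> real \<Rightarrow> (nat \<Rightarrow> real) \<Rightarrow> nat \<Rightarrow> nat \<Rightarrow> real \<Rightarrow> real" where
  "phi k d \<theta> n i m =
     sin (m * k * d * (sin (\<theta> n) - sin (\<theta> i)) / 2) / sin (k * d * (sin (\<theta> n) - sin (\<theta> i)) / 2)"

text \<open>\<open>\<Delta>\<^sub>0\<close> and \<open>\<Delta>\<^sub>1\<close> for the interfering user \<open>i\<close> are the instances \<open>m = M\<^sub>0\<close> and \<open>m = M\<^sub>1\<close>.\<close>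

definition Delta :: "real \<Rightarrow> real \<Rightarrow> (nat \<Rightarrow> real) \<Rightarrow> (nat \<Rightarrow> real) \<Rightarrow> nat \<Rightarrow> nat \<Rightarrow> real \<Rightarrow> real" where
  "Delta k d \<theta> K n i m =
     (K n * K i * (phi k d \<theta> n i m)\<^sup>2 + m * (K n + K i + 1)) / (K i + 1)"

definition Delta2 :: "nat \<Rightarrow> (nat \<Rightarrow> real) \<Rightarrow> (nat \<Rightarrow> real) \<Rightarrow> nat \<Rightarrow> real \<Rightarrow> real" where
  "Delta2 N \<beta> K n M1 =
     M1 * (\<beta> n * ((K n)\<^sup>2 + 4 * K n + 2) + (K n + 1)\<^sup>2 * (\<Sum>i\<in>{1..N} - {n}. \<beta> i))"

definition rate_P ::
  "nat \<Rightarrow> (nat \<Rightarrow> real) \<Rightarrow> (nat \<Rightarrow> real) \<Rightarrow> real \<Rightarrow> real \<Rightarrow> nat \<Rightarrow> (nat \<Rightarrow> real) \<Rightarrow>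
   real \<Rightarrow> real \<Rightarrow> real \<Rightarrow> real \<Rightarrow> real" where
  "rate_P N \<beta> \<theta> k d n K \<rho> pu M0 M1 =
     (let \<alpha> = 1 - \<rho> in
      log 2 (1 +
        pu * \<beta> n * ((2 * K n + 1) * (M0 + \<alpha>\<^sup>2 * M1) + (K n + 1)\<^sup>2 * (M0 + \<alpha> * M1)\<^sup>2) /
        (pu * (K n + 1) *
           (\<Sum>i\<in>{1..N} - {n}. \<beta> i * (Delta k d \<theta> K n i M0 + \<alpha>\<^sup>2 * Delta k d \<theta> K n i M1))
         + (K n + 1)\<^sup>2 * (M0 + \<alpha> * M1)
         + \<alpha> * \<rho> * pu * Delta2 N \<beta> K n M1)))"

definition scaled_rate_P ::
  "nat \<Rightarrow> (nat \<Rightarrow> real) \<Rightarrow> (nat \<Rightarrow> real) \<Rightarrow> real \<Rightarrow> real \<Rightarrow> nat \<Rightarrow> real \<Rightarrow> (nat \<Rightarrow> real) \<Rightarrow>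
   real \<Rightarrow> real \<Rightarrow> real \<Rightarrow> real" where
  "scaled_rate_P N \<beta> \<theta> k d n Eu K \<rho> \<kappa> M =
     rate_P N \<beta> \<theta> k d n K \<rho> (Eu / M) (\<kappa> * M) ((1 - \<kappa>) * M)"

end

(* With p_u = E_u / M, divide the numerator and the denominator of the SINR by M.  Since each phi is
   bounded in M, the interference and quantization terms are O(1/M); the surviving terms
   E_u beta_n (K_n+1)^2 c^2 and (K_n+1)^2 c, where c = rho kappa + alpha, have the quotient
   E_u beta_n c. *)
theory Submission
  imports Defs
begin

lemma tendsto_const_divide_at_top: "((\<lambda>x::real. c / x) \<longlongrightarrow> 0) at_top"
  by (intro tendsto_divide_0[OF tendsto_const] filterlim_at_top_imp_at_infinity filterlim_ident)

text \<open>The numerator of \<open>phi\<close> is a sine, and the bound is uniform in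
  \<open>m\<close>. If the denominator vanishes, both sides are 0 by the convention
  \<open>x / 0 = 0\<close>.\<close>

lemma phi_squared_le: "(phi k d \<theta> n i m)\<^sup>2 \<le> 1 / (sin (k * d * (sin (\<theta> n) - sin (\<theta> i)) / 2))\<^sup>2"
  unfolding phi_def power_divide
  by (intro divide_right_mono) (auto simp: abs_square_le_1)

text \<open>\<open>Delta\<close> is a bounded term plus one linear in M, so it grows at most
  linearly. Of the two factors M divided out here, one comes from p_u = E_u / M and one from
  normalising the SINR denominator by M.\<close>

lemma tendsto_Delta_over_square:
  "((\<lambda>M. Delta k d \<theta> K n i (a * M) / M\<^sup>2) \<longlongrightarrow> 0) at_top"
proof -
  have phi: "((\<lambda>M. (phi k d \<theta> n i (a * M))\<^sup>2 / M\<^sup>2) \<longlongrightarrow> 0) at_top"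
  proof (rule tendsto_sandwich[where f = "\<lambda>_. 0"])
    let ?s = "sin (k * d * (sin (\<theta> n) - sin (\<theta> i)) / 2)"
    show "\<forall>\<^sub>F M in at_top. (phi k d \<theta> n i (a * M))\<^sup>2 / M\<^sup>2 \<le> (1 / ?s / M)\<^sup>2"
      using divide_right_mono[OF phi_squared_le zero_le_power2]
      by (intro always_eventually) (simp add: power_divide power_mult_distrib)
    show "((\<lambda>M. (1 / ?s / M)\<^sup>2) \<longlongrightarrow> 0) at_top"
      using tendsto_power[OF tendsto_const_divide_at_top, of "1 / ?s" 2] by simp
  qed auto
  have "((\<lambda>M. (K n * K i * ((phi k d \<theta> n i (a * M))\<^sup>2 / M\<^sup>2) + a * (K n + K i + 1) / M) / (K i + 1))
      \<longlongrightarrow> (K n * K i * 0 + 0) * inverse (K i + 1)) at_top"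
    \<comment> \<open>As multiplication by a constant inverse, the quotient passes to the limit
      without the side condition \<open>K i + 1 \<noteq> 0\<close>.\<close>
    unfolding divide_inverse[of _ "K i + 1"] by (intro tendsto_intros phi tendsto_const_divide_at_top)
  moreover have "\<forall>\<^sub>F M in at_top.
      (K n * K i * ((phi k d \<theta> n i (a * M))\<^sup>2 / M\<^sup>2) + a * (K n + K i + 1) / M) / (K i + 1)
      = Delta k d \<theta> K n i (a * M) / M\<^sup>2"
    using eventually_gt_at_top[of 0]
    by eventually_elim (simp add: Delta_def add_divide_distrib power2_eq_square mult.commute)
  ultimately show ?thesis
    by (simp add: tendsto_cong)
qed

text \<open>Kept free in \<open>K\<close>, \<open>\<rho>\<close> and \<open>\<kappa>\<close>, so
  that the main theorem can vary each of them. The hypotheses keep the limits of the SINR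
  denominator and of the argument of the logarithm positive.\<close>

lemma tendsto_scaled_rate_P:
  assumes K: "K n \<ge> 0" and pos: "\<rho> * \<kappa> + (1 - \<rho>) > 0" and Eu: "Eu * \<beta> n \<ge> 0"
  shows "((\<lambda>M. scaled_rate_P N \<beta> \<theta> k d n Eu K \<rho> \<kappa> M)
    \<longlongrightarrow> log 2 (1 + Eu * \<beta> n * (\<rho> * \<kappa> + (1 - \<rho>)))) at_top"
proof -
  define \<alpha> c where "\<alpha> = 1 - \<rho>" and "c = \<rho> * \<kappa> + \<alpha>"
  have c: "c > 0" using pos by (simp add: c_def \<alpha>_def)
  have c_eq: "\<kappa> * M + \<alpha> * ((1 - \<kappa>) * M) = c * M" for M
    by (simp add: c_def \<alpha>_def algebra_simps)
  \<comment> \<open>\<open>C\<close> is the slope of \<open>Delta2\<close>, which is linear in its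
    last argument.\<close>
  define C where "C = \<beta> n * ((K n)\<^sup>2 + 4 * K n + 2) + (K n + 1)\<^sup>2 * (\<Sum>i\<in>{1..N} - {n}. \<beta> i)"
  \<comment> \<open>\<open>num\<close> and \<open>den\<close> are the SINR numerator and denominator
    divided by M. Only the coherent gain, quadratic in M before scaling by p_u, survives in
    \<open>num\<close>.\<close>
  define num where "num M = Eu * \<beta> n *
      ((2 * K n + 1) * (\<kappa> + \<alpha>\<^sup>2 * (1 - \<kappa>)) / M + (K n + 1)\<^sup>2 * c\<^sup>2)" for M
  define den where "den M = Eu * (K n + 1) *
        (\<Sum>i\<in>{1..N} - {n}. \<beta> i * (Delta k d \<theta> K n i (\<kappa> * M) / M\<^sup>2
             + \<alpha>\<^sup>2 * (Delta k d \<theta> K n i ((1 - \<kappa>) * M) / M\<^sup>2)))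
      + (K n + 1)\<^sup>2 * c + \<alpha> * \<rho> * Eu * ((1 - \<kappa>) * C / M)" for M
  have "(num \<longlongrightarrow> Eu * \<beta> n * (0 + (K n + 1)\<^sup>2 * c\<^sup>2)) at_top"
    unfolding num_def by (intro tendsto_intros tendsto_const_divide_at_top)
  moreover have "(den \<longlongrightarrow> Eu * (K n + 1) * (\<Sum>i\<in>{1..N} - {n}. \<beta> i * (0 + \<alpha>\<^sup>2 * 0))
      + (K n + 1)\<^sup>2 * c + \<alpha> * \<rho> * Eu * 0) at_top"
    unfolding den_def by (intro tendsto_intros tendsto_const_divide_at_top tendsto_Delta_over_square)
  \<comment> \<open>The limit of \<open>den\<close> is nonzero because \<open>K n + 1 > 0\<close>
    and \<open>c > 0\<close>. The Rician factor then cancels from the quotient.\<close>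
  ultimately have "((\<lambda>M. num M / den M)
      \<longlongrightarrow> (Eu * \<beta> n * ((K n + 1)\<^sup>2 * c\<^sup>2)) / ((K n + 1)\<^sup>2 * c)) at_top"
    using K c by (intro tendsto_divide) auto
  also have "(Eu * \<beta> n * ((K n + 1)\<^sup>2 * c\<^sup>2)) / ((K n + 1)\<^sup>2 * c) = Eu * \<beta> n * c"
    using K c by (simp add: power2_eq_square)
  finally have ratio: "((\<lambda>M. num M / den M) \<longlongrightarrow> Eu * \<beta> n * c) at_top" .
  have "0 < 1 + Eu * \<beta> n * c"
    using Eu c by (simp add: add_pos_nonneg)
  then have "((\<lambda>M. log 2 (1 + num M / den M)) \<longlongrightarrow> log 2 (1 + Eu * \<beta> n * c)) at_top"
    by (intro tendsto_intros ratio) auto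
  moreover have "\<forall>\<^sub>F M in at_top.
      log 2 (1 + num M / den M) = scaled_rate_P N \<beta> \<theta> k d n Eu K \<rho> \<kappa> M"
    using eventually_gt_at_top[of 0]
  proof eventually_elim
    case (elim M)
    \<comment> \<open>\<open>n\<close> and \<open>d\<close> exhibit the common factor M of numerator
      and denominator, which cancels for M > 0.\<close>
    have n: "Eu / M * \<beta> n * ((2 * K n + 1) * (\<kappa> * M + \<alpha>\<^sup>2 * ((1 - \<kappa>) * M)) + (K n + 1)\<^sup>2 * (c * M)\<^sup>2)
        = num M * M"
      using elim by (simp add: num_def field_simps power2_eq_square)
    have s: "(\<Sum>i\<in>{1..N} - {n}. \<beta> i * (Delta k d \<theta> K n i (\<kappa> * M) / M\<^sup>2
             + \<alpha>\<^sup>2 * (Delta k d \<theta> K n i ((1 - \<kappa>) * M) / M\<^sup>2)))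
        = (\<Sum>i\<in>{1..N} - {n}. \<beta> i * (Delta k d \<theta> K n i (\<kappa> * M)
             + \<alpha>\<^sup>2 * Delta k d \<theta> K n i ((1 - \<kappa>) * M))) / M\<^sup>2"
      unfolding sum_divide_distrib by (simp add: add_divide_distrib ring_distribs)
    have d: "Eu / M * (K n + 1) * (\<Sum>i\<in>{1..N} - {n}. \<beta> i * (Delta k d \<theta> K n i (\<kappa> * M)
             + \<alpha>\<^sup>2 * Delta k d \<theta> K n i ((1 - \<kappa>) * M)))
          + (K n + 1)\<^sup>2 * (c * M) + \<alpha> * \<rho> * (Eu / M) * Delta2 N \<beta> K n ((1 - \<kappa>) * M) = den M * M"
      using elim unfolding den_def s Delta2_def C_def[symmetric]
      by (simp add: distrib_right power2_eq_square)
    show ?case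
      using elim unfolding scaled_rate_P_def rate_P_def Let_def \<alpha>_def[symmetric] c_eq n d
      by simp
  qed
  ultimately show ?thesis
    by (simp add: tendsto_cong c_def \<alpha>_def)
qed

theorem mainTheorem2:
  fixes N n :: nat and \<beta> K \<theta> :: "nat \<Rightarrow> real" and k d \<rho> \<alpha> \<kappa> Eu :: real
  assumes "N \<ge> 1" and "n \<in> {1..N}"
    and "\<And>i. i \<in> {1..N} \<Longrightarrow> \<beta> i > 0"
    and "\<And>i. i \<in> {1..N} \<Longrightarrow> K i \<ge> 0"
    and "k > 0" and "d > 0"
    and "\<And>i. i \<in> {1..N} \<Longrightarrow> i \<noteq> n \<Longrightarrow> sin (k * d * (sin (\<theta> n) - sin (\<theta> i)) / 2) \<noteq> 0"
    and "0 \<le> \<rho>" and "\<rho> < 1" and "\<alpha> = 1 - \<rho>"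
    and "0 \<le> \<kappa>" and "\<kappa> \<le> 1"
    and "Eu > 0"
  shows "((\<lambda>M. scaled_rate_P N \<beta> \<theta> k d n Eu K \<rho> \<kappa> M)
            \<longlongrightarrow> log 2 (1 + Eu * \<beta> n * (\<rho> * \<kappa> + \<alpha>))) at_top
    \<and> (\<forall>K'. (\<forall>i\<in>{1..N}. K' i \<ge> 0) \<longrightarrow>
          Lim at_top (\<lambda>M. scaled_rate_P N \<beta> \<theta> k d n Eu K' \<rho> \<kappa> M)
          = Lim at_top (\<lambda>M. scaled_rate_P N \<beta> \<theta> k d n Eu K \<rho> \<kappa> M))
    \<and> \<rho> * \<kappa> + \<alpha> = (1 - \<kappa>) * \<alpha> + \<kappa>
    \<and> mono_on {0..1} (\<lambda>x. Lim at_top (\<lambda>M. scaled_rate_P N \<beta> \<theta> k d n Eu K \<rho> x M))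
    \<and> mono_on {0<..1} (\<lambda>a. Lim at_top (\<lambda>M. scaled_rate_P N \<beta> \<theta> k d n Eu K (1 - a) \<kappa> M))"
proof -
  have \<beta>: "\<beta> n > 0" and K: "K n \<ge> 0"
    using assms(2-4) by auto
  \<comment> \<open>\<open>L\<close> does not occur in the limit, which gives the independence of
    the Rician factors. Positivity of \<open>r * x + (1 - r)\<close> comes from
    \<open>r < 1\<close>.\<close>
  have lim: "((\<lambda>M. scaled_rate_P N \<beta> \<theta> k d n Eu L r x M)
      \<longlongrightarrow> log 2 (1 + Eu * \<beta> n * (r * x + (1 - r)))) at_top"
    if "L n \<ge> 0" "0 \<le> r" "r < 1" "0 \<le> x" for L r x
    using that \<beta> \<open>Eu > 0\<close> by (intro tendsto_scaled_rate_P) (auto simp: add_nonneg_pos)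
  \<comment> \<open>Convergence makes \<open>Lim\<close> equal to the closed form, so the remaining
    claims concern only the argument of a logarithm.\<close>
  have Lim_eq: "Lim at_top (\<lambda>M. scaled_rate_P N \<beta> \<theta> k d n Eu L r x M)
      = log 2 (1 + Eu * \<beta> n * (r * x + (1 - r)))"
    if "L n \<ge> 0" "0 \<le> r" "r < 1" "0 \<le> x" for L r x
    using lim[of L r x] that by (intro tendsto_Lim) auto
  have log_mono: "log 2 (1 + Eu * \<beta> n * s) \<le> log 2 (1 + Eu * \<beta> n * t)" if "0 \<le> s" "s \<le> t" for s t
    using that \<beta> \<open>Eu > 0\<close> by (subst log_le_cancel_iff) (auto simp: add_pos_nonneg)
  have "mono_on {0..1} (\<lambda>x. Lim at_top (\<lambda>M. scaled_rate_P N \<beta> \<theta> k d n Eu K \<rho> x M))"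
    using K \<open>0 \<le> \<rho>\<close> \<open>\<rho> < 1\<close>
    by (intro mono_onI) (auto simp: Lim_eq intro!: log_mono mult_left_mono)
  moreover have "mono_on {0<..1} (\<lambda>a. Lim at_top (\<lambda>M. scaled_rate_P N \<beta> \<theta> k d n Eu K (1 - a) \<kappa> M))"
  proof (rule mono_onI)
    fix a b :: real
    assume ab: "a \<in> {0<..1}" "b \<in> {0<..1}" "a \<le> b"
    \<comment> \<open>With distortion factor \<open>1 - a\<close> the argument is
      \<open>(1 - a) * \<kappa> + a = \<kappa> + a * (1 - \<kappa>)\<close>, affine in
      \<open>a\<close> with slope \<open>1 - \<kappa> \<ge> 0\<close>.\<close>
    have "a * (1 - \<kappa>) \<le> b * (1 - \<kappa>)"
      using ab \<open>\<kappa> \<le> 1\<close> by (intro mult_right_mono) auto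
    then have "(1 - a) * \<kappa> + a \<le> (1 - b) * \<kappa> + b"
      by (simp add: algebra_simps)
    then show "Lim at_top (\<lambda>M. scaled_rate_P N \<beta> \<theta> k d n Eu K (1 - a) \<kappa> M)
        \<le> Lim at_top (\<lambda>M. scaled_rate_P N \<beta> \<theta> k d n Eu K (1 - b) \<kappa> M)"
      using ab K \<open>0 \<le> \<kappa>\<close> by (auto simp: Lim_eq intro!: log_mono)
  qed
  ultimately show ?thesis
    using lim[of K \<rho> \<kappa>] K \<open>n \<in> {1..N}\<close> \<open>0 \<le> \<rho>\<close> \<open>\<rho> < 1\<close> \<open>0 \<le> \<kappa>\<close>
    unfolding \<open>\<alpha> = 1 - \<rho>\<close> by (intro conjI) (auto simp: Lim_eq, simp add: algebra_simps)
qed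

end
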